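(* Let $(\xi_1,\dots,\xi_d)$ be an $S\alpha S$ random vector with $\alpha\in(1,2]$ and associated zonoid $K$. Then $\mathbf{E}(\xi_1|\xi_2,\dots,\xi_d)$ is linear in $\xi_2,\dots,\xi_d$ if and only if the shadow boundary of $K$ in direction $e_1=(1,0,\dots,0)$ is a subset of a $(d-1)$-dimensional hyperplane which does not contain $e_1$.
   Context: A random vector $\xi\in\mathbb{R}^d$ is symmetric $\alpha$-stable ($S\alpha S$) if $\xi$ has the same distribution as $-\xi$ and $a^{1/\alpha}\xi'+b^{1/\alpha}\xi''$ has the same distribution as $(a+b)^{1/\alpha}\xi$ for all $a,b>0$, where $\xi',\xi''$ are independent copies of $\xi$. Its characteristic function is $\mathbf{E}e^{i\langle\xi,u\rangle}=\exp\{-\int_{\mathbb{S}^{d-1}}|\langle u,z\rangle|^\alpha\sigma(dz)\}$ for a symmetric finite measure $\sigma$ (the spectral measure) on the Euclidean unit sphere $\mathbb{S}^{d-1}$. For $\alpha\in[1,2]$ the associated zonoid of $\xi$ is the origin-symmetric convex compact set $K$ whose support function $h(K,u)=\sup\{\langle x,u\rangle:x\in K\}$ satisfies $h(K,u)^\alpha=\int_{\mathbb{S}^{d-1}}|\langle u,z\rangle|^\alpha\sigma(dz)$. The conditional expectation is linear if $\mathbf{E}(\xi_1|\xi_2,\dots,\xi_d)=\sum_{i=2}^da_i\xi_i$ a.s. for some $a_2,\dots,a_d\in\mathbb{R}$. For a convex set $K$ and the one-dimensional subspace $H_x$ spanned by $x\in\mathbb{R}^d$, the shadow boundary of $K$ in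 direction $x$ is $\partial(K+H_x)\cap\partial K$, where $\partial$ is the topological boundary in $\mathbb{R}^d$.
   Formalization: The "only if" direction is proved assuming that ξ_2,…,ξ_d satisfy no nontrivial linear relation a.s.; without this it fails, e.g. for d=2, ξ=(ξ_1,0), where the shadow boundary is K itself, a segment along e_1. The "if" direction is unconditional. *)

theory Defs
  imports "HOL-Probability.Probability"
begin

section \<open>Symmetric stable random vectors\<close>

text \<open>
  The independent copies of \<open>X\<close> are its compositions with the two projections of the product
  space \<open>M \<Otimes>\<^sub>M M\<close>; any other choice of independent copies gives the same laws.
\<close>

definition sym_stable ::
    "real \<Rightarrow> 'w measure \<Rightarrow> ('w \<Rightarrow> 'a::euclidean_space) \<Rightarrow> bool" where
  "sym_stable \<alpha> M X \<longleftrightarrow>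
     distr M borel X = distr M borel (\<lambda>\<omega>. - X \<omega>) \<and>
     (\<forall>a>0. \<forall>b>0.
        distr (M \<Otimes>\<^sub>M M) borel
          (\<lambda>(\<omega>', \<omega>''). (a powr (1 / \<alpha>)) *\<^sub>R X \<omega>' + (b powr (1 / \<alpha>)) *\<^sub>R X \<omega>'') =
        distr M borel (\<lambda>\<omega>. ((a + b) powr (1 / \<alpha>)) *\<^sub>R X \<omega>))"

definition spectral_measure ::
    "real \<Rightarrow> 'w measure \<Rightarrow> ('w \<Rightarrow> 'a::euclidean_space) \<Rightarrow> 'a measure \<Rightarrow> bool" where
  "spectral_measure \<alpha> M X \<sigma> \<longleftrightarrow>
     sets \<sigma> = sets (restrict_space borel (sphere 0 1)) \<and>
     finite_measure \<sigma> \<and>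
     distr \<sigma> \<sigma> uminus = \<sigma> \<and>
     (\<forall>u. (CLINT \<omega>|M. iexp (X \<omega> \<bullet> u)) =
          complex_of_real (exp (- (LINT z|\<sigma>. \<bar>u \<bullet> z\<bar> powr \<alpha>))))"

section \<open>The associated zonoid\<close>

text \<open>A real-valued supremum, hence meaningful only for nonempty bounded \<open>K\<close>.\<close>

definition support_function :: "'a::euclidean_space set \<Rightarrow> 'a \<Rightarrow> real" where
  "support_function K u = (SUP x\<in>K. x \<bullet> u)"

text \<open>
  For \<open>\<alpha> = 2\<close> the spectral measure is not unique, but the integral below, and so \<open>K\<close>, is
  determined by the characteristic function of \<open>X\<close>.
\<close>

definition associated_zonoid ::
    "real \<Rightarrow> 'w measure \<Rightarrow> ('w \<Rightarrow> 'a::euclidean_space) \<Rightarrow> 'a set \<Rightarrow> bool" where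
  "associated_zonoid \<alpha> M X K \<longleftrightarrow>
     K \<noteq> {} \<and> convex K \<and> compact K \<and> uminus ` K = K \<and>
     (\<exists>\<sigma>. spectral_measure \<alpha> M X \<sigma> \<and>
          (\<forall>u. support_function K u powr \<alpha> = (LINT z|\<sigma>. \<bar>u \<bullet> z\<bar> powr \<alpha>)))"

definition shadow_boundary :: "'a::euclidean_space set \<Rightarrow> 'a \<Rightarrow> 'a set" where
  "shadow_boundary K x = frontier (K + span {x}) \<inter> frontier K"

section \<open>Linear conditional expectation\<close>

text \<open>The sub-sigma-algebra generated by the coordinates of \<open>X\<close> other than the \<open>k\<close>-th.\<close>

definition other_coords_algebra ::
    "'w measure \<Rightarrow> ('w \<Rightarrow> real ^ 'n) \<Rightarrow> 'n \<Rightarrow> 'w measure" where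
  "other_coords_algebra M X k =
     vimage_algebra (space M) (\<lambda>\<omega>. \<lambda>i\<in>- {k}. X \<omega> $ i) (\<Pi>\<^sub>M i\<in>- {k}. borel)"

lemma subalgebra_other_coords_algebra:
  assumes "X \<in> borel_measurable M"
  shows "subalgebra M (other_coords_algebra M X k)"
proof -
  have "(\<lambda>\<omega>. \<lambda>i\<in>- {k}. X \<omega> $ i) \<in> M \<rightarrow>\<^sub>M (\<Pi>\<^sub>M i\<in>- {k}. borel)"
  proof (rule measurable_restrict)
    show "(\<lambda>\<omega>. X \<omega> $ i) \<in> borel_measurable M" for i
      by (rule measurable_compose[OF assms borel_measurable_continuous_onI])
         (intro continuous_intros)
  qed
  then show ?thesis
    unfolding subalgebra_def other_coords_algebra_def
    using sets_image_in_sets[OF refl] by simp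
qed

definition linear_cond_exp ::
    "'w measure \<Rightarrow> ('w \<Rightarrow> real ^ 'n) \<Rightarrow> 'n \<Rightarrow> bool" where
  "linear_cond_exp M X k \<longleftrightarrow>
     (\<exists>a. AE \<omega> in M.
        real_cond_exp M (other_coords_algebra M X k) (\<lambda>\<omega>. X \<omega> $ k) \<omega> =
        (\<Sum>i\<in>- {k}. a i * X \<omega> $ i))"

end

theory Submission
  imports Defs
begin

text \<open>
  Write \<open>h\<close> for the support function of \<open>K\<close>, \<open>e\<close> for \<open>axis k 1\<close>, and \<open>X \<bullet> v\<close> for the linear form of \<open>X\<close>
  with coefficient vector \<open>v\<close>. The characteristic function of \<open>X\<close> at \<open>u\<close> is \<open>exp (- h(u)\<^sup>\<alpha>)\<close>.
  Everything rests on reading one vector \<open>v\<close> with \<open>v $ k = 1\<close> in two ways: as the coefficients of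
  the residual \<open>X \<bullet> v = X $ k - (\<Sum>i\<noteq>k. a i * X $ i)\<close> of a linear prediction, and as the normal of a
  hyperplane through the origin that does not contain \<open>e\<close>.

  On the probabilistic side, the prediction is the conditional expectation exactly if the weight
  \<open>X \<bullet> v\<close> integrates to zero over every event generated by the other coordinates. By uniqueness of
  Fourier transforms this is the condition \<open>E ((X \<bullet> v) exp (\<i> (X \<bullet> u))) = 0\<close> for all \<open>u\<close> orthogonal to
  \<open>e\<close> (\<open>linear_cond_exp_if_moments_zero\<close>, \<open>linear_cond_exp_imp_moments_zero\<close>). Since \<open>X\<close> is
  integrable for \<open>\<alpha> > 1\<close>, this moment is up to the factor \<open>\<i>\<close> the derivative at \<open>s = 0\<close> of
  \<open>exp (- h(u + s v)\<^sup>\<alpha>)\<close> (\<open>zonoid_derivative\<close>).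

  On the geometric side, the shadow boundary in direction \<open>e\<close> is the union of the faces of \<open>K\<close> with
  outer normal \<open>u \<noteq> 0\<close> orthogonal to \<open>e\<close> (\<open>shadow_boundary_iff_supported\<close>). A point \<open>x\<close> of the face
  with normal \<open>u\<close> gives the bound \<open>h(u + s v) \<ge> h(u) + s (x \<bullet> v)\<close>, with equality at \<open>s = 0\<close>. If
  \<open>x \<bullet> v = 0\<close>, then \<open>exp (- h(u + s v)\<^sup>\<alpha>)\<close> is maximal at \<open>s = 0\<close> and its derivative vanishes.
  Conversely, if the derivative vanishes and \<open>h(u) > 0\<close>, comparing it with that of
  \<open>exp (- (h(u) + s (x \<bullet> v))\<^sup>\<alpha>)\<close> forces \<open>x \<bullet> v = 0\<close>. The differentiability of \<open>h(u + s v)\<^sup>\<alpha>\<close> thus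
  comes from probability, and one-sided comparisons replace any subdifferential calculus for \<open>h\<close>.
  Nondegeneracy of the other coordinates is what makes \<open>h(u)\<close> positive in the converse
  (\<open>support_function_zero_imp_AE_zero\<close>).
\<close>

section \<open>Integrability from the characteristic function\<close>

text \<open>
  A dyadic scaling brings \<open>\<bar>x\<bar>\<close> into \<open>[1, 2]\<close>, where \<open>1 - cos\<close> is bounded below. The gain is that
  the right-hand side is nonnegative for every \<open>n\<close>, so that a sum over all \<open>n\<close> dominates \<open>\<bar>x\<bar>\<close>.
\<close>

lemma abs_le_dyadic_versine:
  fixes x :: real
  assumes "1 \<le> \<bar>x\<bar>"
  obtains n where "\<bar>x\<bar> \<le> 2 / (1 - cos 1) * (2 ^ n * (1 - cos (x / 2 ^ n)))"
proof -
  define n where "n = nat \<lfloor>log 2 \<bar>x\<bar>\<rfloor>"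
  define y where "y = \<bar>x\<bar> / 2 ^ n"
  have "0 \<le> log 2 \<bar>x\<bar>"
    using assms by simp
  then have "real n \<le> log 2 \<bar>x\<bar>" "log 2 \<bar>x\<bar> < real n + 1"
    unfolding n_def by linarith+
  then have "2 powr real n \<le> \<bar>x\<bar>" "\<bar>x\<bar> < 2 powr (real n + 1)"
    using assms by (simp_all add: le_log_iff log_less_iff)
  then have y: "1 \<le> y" "y \<le> 2"
    by (simp_all add: y_def powr_add powr_realpow field_simps)
  have "y \<le> pi"
    using y pi_gt3 by linarith
  then have "cos y \<le> cos 1"
    using y by (intro cos_monotone_0_pi_le) auto
  moreover have "cos (1::real) < 1"
    using cos_monotone_0_pi[of 0 1] pi_gt3 by simp
  ultimately have "2 \<le> 2 / (1 - cos 1) * (1 - cos y)"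
    by (simp add: field_simps)
  with \<open>y \<le> 2\<close> have "y * 2 ^ n \<le> 2 / (1 - cos 1) * (1 - cos y) * 2 ^ n"
    by (intro mult_right_mono) auto
  moreover have "cos y = cos (x / 2 ^ n)"
    unfolding y_def by (metis abs_divide abs_of_pos cos_abs_real zero_less_numeral zero_less_power)
  moreover have "\<bar>x\<bar> = y * 2 ^ n"
    by (simp add: y_def)
  ultimately show thesis
    by (intro that[of n]) (simp add: mult_ac)
qed

text \<open>
  By the dyadic bound, \<open>\<bar>Y\<bar>\<close> is at most \<open>1\<close> plus a multiple of \<open>\<Sum>n. 2\<^sup>n (1 - cos (Y / 2\<^sup>n))\<close>. The
  expectation of the \<open>n\<close>-th term is at most \<open>C 2\<^sup>n 2\<^sup>-\<^sup>n\<^sup>\<alpha>\<close>, and these form a convergent geometric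
  series precisely because \<open>\<alpha> > 1\<close>.
\<close>

lemma (in prob_space) integrable_if_char_near_one:
  fixes Y :: "'a \<Rightarrow> real"
  assumes [measurable]: "Y \<in> borel_measurable M" and "1 < \<alpha>"
    and bound: "\<And>t. (LINT \<omega>|M. 1 - cos (t * Y \<omega>)) \<le> C * \<bar>t\<bar> powr \<alpha>"
  shows "integrable M Y"
proof -
  define c :: real where "c = 2 / (1 - cos 1)"
  define q where "q = 2 powr (1 - \<alpha>)"
  define g where "g n \<omega> = 2 ^ n * (1 - cos (Y \<omega> / 2 ^ n))" for n \<omega>
  have g_meas [measurable]: "g n \<in> borel_measurable M" for n
    unfolding g_def by measurable
  have "cos (1::real) < 1"
    using cos_monotone_0_pi[of 0 1] pi_gt3 by simp
  then have c: "0 \<le> c"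
    by (simp add: c_def)
  have g_nonneg: "0 \<le> g n \<omega>" for n \<omega>
    by (simp add: g_def)
  have g_int: "integrable M (g n)" for n
    by (rule integrable_const_bound[where B = "2 ^ n * 2"])
       (auto simp: g_def abs_mult intro!: AE_I2 abs_leI intro: order_trans[OF _ cos_ge_minus_one])
  have C: "0 \<le> C"
  proof -
    have "0 \<le> (LINT \<omega>|M. 1 - cos (1 * Y \<omega>))"
      by (intro Bochner_Integration.integral_nonneg) simp
    also have "\<dots> \<le> C * \<bar>1\<bar> powr \<alpha>"
      by (rule bound)
    finally show ?thesis
      by simp
  qed
  have q_power: "2 ^ n * \<bar>1 / 2 ^ n\<bar> powr \<alpha> = q ^ n" for n :: nat
  proof -
    have "2 ^ n * \<bar>1 / 2 ^ n\<bar> powr \<alpha> = 2 powr real n * (2 powr (- real n)) powr \<alpha>"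
      by (simp add: powr_realpow powr_minus divide_inverse)
    also have "\<dots> = 2 powr (real n * (1 - \<alpha>))"
      by (simp add: powr_powr powr_add[symmetric] algebra_simps)
    also have "\<dots> = q ^ n"
      by (simp add: q_def powr_powr powr_realpow[symmetric] mult.commute)
    finally show ?thesis .
  qed
  have g_integral: "(\<integral>\<^sup>+\<omega>. ennreal (g n \<omega>) \<partial>M) \<le> ennreal (C * q ^ n)" for n
  proof -
    have "(LINT \<omega>|M. g n \<omega>) = 2 ^ n * (LINT \<omega>|M. 1 - cos (1 / 2 ^ n * Y \<omega>))"
      by (simp add: g_def)
    also have "\<dots> \<le> 2 ^ n * (C * \<bar>1 / 2 ^ n\<bar> powr \<alpha>)"
      by (intro mult_left_mono bound) simp
    also have "\<dots> = C * q ^ n"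
      using q_power[of n] by (metis mult.left_commute)
    finally show ?thesis
      using g_int g_nonneg by (subst nn_integral_eq_integral) (auto intro!: ennreal_leI)
  qed
  have "q < 1"
    unfolding q_def using \<open>1 < \<alpha>\<close> by (subst powr_less_one) auto
  then have summable: "summable (\<lambda>n. C * q ^ n)"
    by (intro summable_mult summable_geometric) (simp add: q_def)
  have pointwise: "ennreal (norm (Y \<omega>)) \<le> 1 + ennreal c * (\<Sum>n. ennreal (g n \<omega>))" for \<omega>
  proof (cases "1 \<le> \<bar>Y \<omega>\<bar>")
    case True
    then obtain n where "\<bar>Y \<omega>\<bar> \<le> c * g n \<omega>"
      unfolding c_def g_def by (rule abs_le_dyadic_versine)
    then have "ennreal (norm (Y \<omega>)) \<le> ennreal c * ennreal (g n \<omega>)"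
      using c g_nonneg by (simp add: ennreal_mult[symmetric] ennreal_leI)
    also have "ennreal (g n \<omega>) \<le> (\<Sum>n. ennreal (g n \<omega>))"
      using sum_le_suminf[of "\<lambda>n. ennreal (g n \<omega>)" "{n}"] by simp
    finally show ?thesis
      by (metis add_increasing mult_left_mono zero_le)
  next
    case False
    then have "ennreal (norm (Y \<omega>)) \<le> ennreal 1"
      by (intro ennreal_leI) simp
    then show ?thesis
      by (simp add: add_increasing2)
  qed
  have "(\<integral>\<^sup>+\<omega>. ennreal (norm (Y \<omega>)) \<partial>M) \<le> (\<integral>\<^sup>+\<omega>. 1 + ennreal c * (\<Sum>n. ennreal (g n \<omega>)) \<partial>M)"
    by (intro nn_integral_mono pointwise)
  also have "\<dots> = 1 + ennreal c * (\<Sum>n. \<integral>\<^sup>+\<omega>. ennreal (g n \<omega>) \<partial>M)"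
    by (subst nn_integral_add, simp, simp, subst nn_integral_cmult, simp, subst nn_integral_suminf)
       (auto simp: emeasure_space_1)
  also have "\<dots> \<le> 1 + ennreal c * (\<Sum>n. ennreal (C * q ^ n))"
    by (intro add_left_mono mult_left_mono suminf_le g_integral) auto
  also have "(\<Sum>n. ennreal (C * q ^ n)) = ennreal (\<Sum>n. C * q ^ n)"
    using C summable by (intro suminf_ennreal2) (auto simp: q_def)
  also have "1 + ennreal c * ennreal (\<Sum>n. C * q ^ n) < \<infinity>"
    by (simp add: ennreal_mult_eq_top_iff less_top[symmetric])
  finally show ?thesis
    by (intro integrableI_bounded) auto
qed

section \<open>Uniqueness for weighted characteristic functions\<close>

text \<open>
  The positive and the negative part of \<open>f\<close> have the same total mass (take \<open>t = 0\<close>). Normalised by it,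
  they are densities of two probability measures whose images under \<open>Y\<close> have the same characteristic
  function, hence coincide by Levy's uniqueness theorem.
\<close>

lemma weighted_iexp_zero_imp_indicator_zero_real:
  fixes f Y :: "'w \<Rightarrow> real"
  assumes f: "integrable M f" and [measurable]: "Y \<in> borel_measurable M"
    and zero: "\<And>t. (CLINT \<omega>|M. of_real (f \<omega>) * iexp (t * Y \<omega>)) = 0"
    and [measurable]: "B \<in> sets borel"
  shows "(LINT \<omega>|M. f \<omega> * indicator B (Y \<omega>)) = 0"
proof -
  define p where "p \<omega> = max (f \<omega>) 0" for \<omega>
  define m where "m \<omega> = max (- f \<omega>) 0" for \<omega>
  have f_eq: "f \<omega> = p \<omega> - m \<omega>" for \<omega>
    by (simp add: p_def m_def)
  have pm: "integrable M p" "integrable M m" "\<And>\<omega>. 0 \<le> p \<omega>" "\<And>\<omega>. 0 \<le> m \<omega>"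
    unfolding p_def m_def using f by auto
  note [measurable] = borel_measurable_integrable[OF pm(1)] borel_measurable_integrable[OF pm(2)]
  have int_mult: "integrable M (\<lambda>\<omega>. complex_of_real (h \<omega>) * iexp (t * Y \<omega>))"
    if "integrable M h" for h and t
  proof (rule Bochner_Integration.integrable_bound[OF that])
    show "(\<lambda>\<omega>. complex_of_real (h \<omega>) * iexp (t * Y \<omega>)) \<in> borel_measurable M"
      using borel_measurable_integrable[OF that] by measurable
  qed (simp add: norm_mult)
  have transform_eq: "(CLINT \<omega>|M. p \<omega> * iexp (t * Y \<omega>)) = (CLINT \<omega>|M. m \<omega> * iexp (t * Y \<omega>))" for t
    using zero[of t] int_mult[OF pm(1)] int_mult[OF pm(2)]
    by (simp add: f_eq left_diff_distrib)
  define s where "s = (LINT \<omega>|M. p \<omega>)"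
  have s_m: "(LINT \<omega>|M. m \<omega>) = s"
    using transform_eq[of 0] by (simp add: s_def)
  have "0 \<le> s"
    unfolding s_def using pm by (intro Bochner_Integration.integral_nonneg)
  show ?thesis
  proof (cases "s = 0")
    case True
    then have "AE \<omega> in M. p \<omega> = 0" "AE \<omega> in M. m \<omega> = 0"
      using integral_nonneg_eq_0_iff_AE[OF pm(1)] integral_nonneg_eq_0_iff_AE[OF pm(2)] pm s_m
      by (auto simp: s_def)
    then have "AE \<omega> in M. f \<omega> * indicator B (Y \<omega>) = 0"
      by eventually_elim (simp add: f_eq)
    then show ?thesis
      by (rule integral_eq_zero_AE)
  next
    case False
    with \<open>0 \<le> s\<close> have s: "0 < s"
      by simp
    define D where "D h = distr (density M (\<lambda>\<omega>. h \<omega> / s)) borel Y" for h :: "'w \<Rightarrow> real"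
    have D: "real_distribution (D h)"
      "char (D h) t = (CLINT \<omega>|M. h \<omega> * iexp (t * Y \<omega>)) / s"
      "measure (D h) B = (LINT \<omega>|M. h \<omega> * indicator B (Y \<omega>)) / s"
      if h: "integrable M h" "\<And>\<omega>. 0 \<le> h \<omega>" "(LINT \<omega>|M. h \<omega>) = s" for h t
    proof -
      note [measurable] = borel_measurable_integrable[OF h(1)]
      have em: "emeasure (density M (\<lambda>\<omega>. h \<omega> / s)) (space M) = 1"
        using h s by (simp add: emeasure_density nn_integral_eq_integral cong: nn_integral_cong_simp)
      show "real_distribution (D h)"
      proof -
        interpret P: prob_space "density M (\<lambda>\<omega>. h \<omega> / s)"
          using em by (intro prob_spaceI) simp
        show ?thesis
          unfolding D_def by (rule P.real_distribution_distr) simp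
      qed
      show "char (D h) t = (CLINT \<omega>|M. h \<omega> * iexp (t * Y \<omega>)) / s"
        unfolding D_def char_def using h s
        by (subst integral_distr, simp, simp, subst integral_density)
           (auto simp: scaleR_conv_of_real)
      show "measure (D h) B = (LINT \<omega>|M. h \<omega> * indicator B (Y \<omega>)) / s"
      proof -
        interpret R: real_distribution "D h" by fact
        have "measure (D h) B = (LINT x|D h. indicator B x)"
          by simp
        also have "\<dots> = (LINT \<omega>|M. h \<omega> * indicator B (Y \<omega>)) / s"
          unfolding D_def using h s
          by (subst integral_distr, simp, simp, subst integral_density) auto
        finally show ?thesis .
      qed
    qed
    have "D p = D m"
    proof (rule Levy_uniqueness)
      show "char (D p) = char (D m)"
        using D(2)[OF pm(1,3)] D(2)[OF pm(2,4)] s_m s_def transform_eq by auto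
    qed (use D pm s_def s_m in auto)
    then have "(LINT \<omega>|M. p \<omega> * indicator B (Y \<omega>)) = (LINT \<omega>|M. m \<omega> * indicator B (Y \<omega>))"
      using D(3)[OF pm(1,3)] D(3)[OF pm(2,4)] s_m s_def s by simp
    moreover have "integrable M (\<lambda>\<omega>. p \<omega> * indicator B (Y \<omega>))" "integrable M (\<lambda>\<omega>. m \<omega> * indicator B (Y \<omega>))"
      by (rule Bochner_Integration.integrable_bound[OF pm(1)], auto simp: indicator_def)
         (rule Bochner_Integration.integrable_bound[OF pm(2)], auto simp: indicator_def)
    ultimately show ?thesis
      by (simp add: f_eq left_diff_distrib)
  qed
qed

text \<open>
  Complex weights are needed for the passage to several variables, where exponentials in the
  remaining variables are absorbed into the weight. The hypothesis for \<open>- t\<close> transfers it to the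
  conjugate of \<open>f\<close>, and so to its real and imaginary parts.
\<close>

lemma weighted_iexp_zero_imp_indicator_zero:
  fixes f :: "'w \<Rightarrow> complex" and Y :: "'w \<Rightarrow> real"
  assumes f: "integrable M f" and [measurable]: "Y \<in> borel_measurable M"
    and zero: "\<And>t. (CLINT \<omega>|M. f \<omega> * iexp (t * Y \<omega>)) = 0"
    and [measurable]: "B \<in> sets borel"
  shows "(CLINT \<omega>|M. f \<omega> * indicator B (Y \<omega>)) = 0"
proof -
  note [measurable] = borel_measurable_integrable[OF f]
  have int: "integrable M (\<lambda>\<omega>. f \<omega> * iexp (t * Y \<omega>))" for t
    by (rule Bochner_Integration.integrable_bound[OF f]) (auto simp: norm_mult)
  have int_cnj: "integrable M (\<lambda>\<omega>. cnj (f \<omega>) * iexp (t * Y \<omega>))" for t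
  proof (rule Bochner_Integration.integrable_bound[OF f])
    have "(\<lambda>\<omega>. cnj (f \<omega>)) \<in> borel_measurable M"
      using f by (intro borel_measurable_integrable) simp
    then show "(\<lambda>\<omega>. cnj (f \<omega>) * iexp (t * Y \<omega>)) \<in> borel_measurable M"
      by measurable
  qed (simp add: norm_mult)
  have zero_cnj: "(CLINT \<omega>|M. cnj (f \<omega>) * iexp (t * Y \<omega>)) = 0" for t
  proof -
    have "(CLINT \<omega>|M. cnj (f \<omega>) * iexp (t * Y \<omega>)) = (CLINT \<omega>|M. cnj (f \<omega> * iexp (- t * Y \<omega>)))"
      by (simp add: exp_cnj)
    also have "\<dots> = cnj (CLINT \<omega>|M. f \<omega> * iexp (- t * Y \<omega>))"
      by (rule Bochner_Integration.integral_cnj)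
    also have "\<dots> = 0"
      using zero[of "- t"] by simp
    finally show ?thesis .
  qed
  have Re: "(CLINT \<omega>|M. of_real (Re (f \<omega>)) * iexp (t * Y \<omega>)) = 0" for t
  proof -
    have "of_real (Re (f \<omega>)) * iexp (t * Y \<omega>)
        = (f \<omega> * iexp (t * Y \<omega>) + cnj (f \<omega>) * iexp (t * Y \<omega>)) / 2" for \<omega>
      by (simp add: distrib_right[symmetric] complex_add_cnj)
    then show ?thesis
      using int[of t] int_cnj[of t] zero[of t] zero_cnj[of t] by (simp only:) simp
  qed
  have Im: "(CLINT \<omega>|M. of_real (Im (f \<omega>)) * iexp (t * Y \<omega>)) = 0" for t
  proof -
    have "of_real (Im (f \<omega>)) * iexp (t * Y \<omega>)
        = (f \<omega> * iexp (t * Y \<omega>) - cnj (f \<omega>) * iexp (t * Y \<omega>)) / (2 * \<i>)" for \<omega>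
      by (subst nonzero_eq_divide_eq)
         (simp_all only: left_diff_distrib[symmetric] complex_diff_cnj, simp_all add: mult_ac)
    then show ?thesis
      using int[of t] int_cnj[of t] zero[of t] zero_cnj[of t] by (simp only:) simp
  qed
  have int_ind: "integrable M (\<lambda>\<omega>. f \<omega> * indicator B (Y \<omega>))"
    by (rule Bochner_Integration.integrable_bound[OF f]) (auto simp: indicator_def)
  show ?thesis
  proof (rule complex_eqI)
    have "Re (CLINT \<omega>|M. f \<omega> * indicator B (Y \<omega>)) = (LINT \<omega>|M. Re (f \<omega> * indicator B (Y \<omega>)))"
      by (rule integral_Re[OF int_ind, symmetric])
    also have "\<dots> = (LINT \<omega>|M. Re (f \<omega>) * indicator B (Y \<omega>))"
      by (intro Bochner_Integration.integral_cong) (auto simp: indicator_def)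
    also have "\<dots> = 0"
      using f Re by (intro weighted_iexp_zero_imp_indicator_zero_real) auto
    finally show "Re (CLINT \<omega>|M. f \<omega> * indicator B (Y \<omega>)) = Re 0"
      by simp
    have "Im (CLINT \<omega>|M. f \<omega> * indicator B (Y \<omega>)) = (LINT \<omega>|M. Im (f \<omega> * indicator B (Y \<omega>)))"
      by (rule integral_Im[OF int_ind, symmetric])
    also have "\<dots> = (LINT \<omega>|M. Im (f \<omega>) * indicator B (Y \<omega>))"
      by (intro Bochner_Integration.integral_cong) (auto simp: indicator_def)
    also have "\<dots> = 0"
      using f Im by (intro weighted_iexp_zero_imp_indicator_zero_real) auto
    finally show "Im (CLINT \<omega>|M. f \<omega> * indicator B (Y \<omega>)) = Im 0"
      by simp
  qed
qed

text \<open>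
  The variables are treated one at a time: for an index \<open>j\<close> outside \<open>S\<close>, the product of all
  factors that do not involve \<open>Y j\<close> is an integrable weight whose transform with respect to \<open>Y j\<close>
  vanishes, and the one-dimensional result replaces the exponential in \<open>Y j\<close> by an indicator.
\<close>

lemma weighted_iexp_zero_imp_box_zero:
  fixes Z :: "'w \<Rightarrow> complex" and Y :: "'i \<Rightarrow> 'w \<Rightarrow> real"
  assumes "finite I" and Z: "integrable M Z"
    and Y: "\<And>i. i \<in> I \<Longrightarrow> Y i \<in> borel_measurable M"
    and zero: "\<And>t. (CLINT \<omega>|M. Z \<omega> * iexp (\<Sum>i\<in>I. t i * Y i \<omega>)) = 0"
    and B: "\<And>i. i \<in> I \<Longrightarrow> B i \<in> sets borel"
    and "S \<subseteq> I"
  shows "(CLINT \<omega>|M. Z \<omega> * (\<Prod>i\<in>S. indicator (B i) (Y i \<omega>)) * iexp (\<Sum>i\<in>I - S. t i * Y i \<omega>)) = 0"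
proof -
  have "finite S"
    using \<open>finite I\<close> \<open>S \<subseteq> I\<close> by (rule finite_subset[rotated])
  from this \<open>S \<subseteq> I\<close> show ?thesis
  proof (induction S arbitrary: t rule: finite_induct)
    case empty
    with zero[of t] show ?case
      by simp
  next
    case (insert j S)
    then have j: "j \<in> I" and SI: "S \<subseteq> I"
      by auto
    have meas [measurable]: "Y i \<in> borel_measurable M" "B i \<in> sets borel" if "i \<in> I" for i
      using Y B that by auto
    note [measurable] = meas(1)[OF j] meas(2)[OF j] borel_measurable_integrable[OF Z]
    define f where "f \<omega> = Z \<omega> * (\<Prod>i\<in>S. indicator (B i) (Y i \<omega>)) *
        iexp (\<Sum>i\<in>I - insert j S. t i * Y i \<omega>)" for \<omega>
    have f_meas: "f \<in> borel_measurable M"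
    proof -
      have "(\<lambda>\<omega>. \<Prod>i\<in>S. indicator (B i) (Y i \<omega>) :: complex) \<in> borel_measurable M"
      proof (rule borel_measurable_prod)
        fix i assume "i \<in> S"
        with SI have "i \<in> I" by auto
        note [measurable] = meas(1)[OF this] meas(2)[OF this]
        show "(\<lambda>\<omega>. indicator (B i) (Y i \<omega>) :: complex) \<in> borel_measurable M"
          by measurable
      qed
      moreover have "(\<lambda>\<omega>. \<Sum>i\<in>I - insert j S. t i * Y i \<omega>) \<in> borel_measurable M"
        by (intro borel_measurable_sum borel_measurable_times) (auto intro: Y)
      ultimately show ?thesis
        unfolding f_def by measurable
    qed
    have f_int: "integrable M f"
    proof (rule Bochner_Integration.integrable_bound[OF Z f_meas], rule AE_I2)
      fix \<omega>
      have "norm (\<Prod>i\<in>S. indicator (B i) (Y i \<omega>) :: complex) \<le> 1"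
        unfolding prod_norm[symmetric] by (intro prod_le_1) (auto simp: indicator_def)
      then show "norm (f \<omega>) \<le> norm (Z \<omega>)"
        unfolding f_def by (simp add: norm_mult mult_left_le)
    qed
    have I_diff: "I - S = insert j (I - insert j S)"
      using j insert.hyps by auto
    have "(CLINT \<omega>|M. f \<omega> * indicator (B j) (Y j \<omega>)) = 0"
    proof (rule weighted_iexp_zero_imp_indicator_zero[OF f_int])
      fix r
      have "(\<Sum>i\<in>I - S. (t(j := r)) i * Y i \<omega>)
          = r * Y j \<omega> + (\<Sum>i\<in>I - insert j S. t i * Y i \<omega>)" for \<omega>
        unfolding I_diff using \<open>finite I\<close> by (subst sum.insert) (auto intro!: sum.cong)
      then show "(CLINT \<omega>|M. f \<omega> * iexp (r * Y j \<omega>)) = 0"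
        using insert.IH[OF SI, of "t(j := r)"]
        by (simp add: f_def exp_add distrib_left mult_ac)
    qed simp_all
    then show ?case
      unfolding f_def using insert.hyps by (simp add: mult_ac)
  qed
qed

text \<open>
  Uniqueness of Fourier transforms for a signed weight in several variables. The image measures of
  the positive and the negative part of \<open>Z\<close> agree on boxes, which generate the product algebra.
\<close>

lemma weighted_iexp_zero_imp_set_integral_zero:
  fixes Z :: "'w \<Rightarrow> real" and Y :: "'i \<Rightarrow> 'w \<Rightarrow> real"
  assumes "finite I" and Z: "integrable M Z"
    and Y: "\<And>i. i \<in> I \<Longrightarrow> Y i \<in> borel_measurable M"
    and zero: "\<And>t. (CLINT \<omega>|M. of_real (Z \<omega>) * iexp (\<Sum>i\<in>I. t i * Y i \<omega>)) = 0"
    and A: "A \<in> sets (vimage_algebra (space M) (\<lambda>\<omega>. \<lambda>i\<in>I. Y i \<omega>) (\<Pi>\<^sub>M i\<in>I. borel))"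
  shows "(LINT \<omega>:A|M. Z \<omega>) = 0"
proof -
  let ?N = "\<Pi>\<^sub>M i\<in>I. (borel :: real measure)"
  let ?Y = "\<lambda>\<omega>. \<lambda>i\<in>I. Y i \<omega>"
  have YM [measurable]: "?Y \<in> M \<rightarrow>\<^sub>M ?N"
    using Y by (intro measurable_restrict) auto
  have Y_space: "?Y \<in> space M \<rightarrow> space ?N"
    by (auto simp: space_PiM)
  define p where "p \<omega> = max (Z \<omega>) 0" for \<omega>
  define m where "m \<omega> = max (- Z \<omega>) 0" for \<omega>
  have Z_eq: "Z \<omega> = p \<omega> - m \<omega>" for \<omega>
    by (simp add: p_def m_def)
  have pm: "integrable M p" "integrable M m" "\<And>\<omega>. 0 \<le> p \<omega>" "\<And>\<omega>. 0 \<le> m \<omega>"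
    unfolding p_def m_def using Z by auto
  note [measurable] = borel_measurable_integrable[OF pm(1)] borel_measurable_integrable[OF pm(2)]
  have int_ind: "integrable M (\<lambda>\<omega>. h \<omega> * indicator E (?Y \<omega>))"
    if "integrable M h" "E \<in> sets ?N" for h :: "'w \<Rightarrow> real" and E
  proof (rule Bochner_Integration.integrable_bound[OF that(1)])
    note [measurable] = that(2) borel_measurable_integrable[OF that(1)]
    show "(\<lambda>\<omega>. h \<omega> * indicator E (?Y \<omega>)) \<in> borel_measurable M"
      by measurable
  qed (auto simp: indicator_def)
  define D where "D h = distr (density M (\<lambda>\<omega>. ennreal (h \<omega>))) ?N ?Y" for h :: "'w \<Rightarrow> real"
  have D: "emeasure (D h) E = ennreal (LINT \<omega>|M. h \<omega> * indicator E (?Y \<omega>))"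
    if h: "integrable M h" "\<And>\<omega>. 0 \<le> h \<omega>" and E: "E \<in> sets ?N" for h E
  proof -
    note [measurable] = E borel_measurable_integrable[OF h(1)]
    have "emeasure (D h) E = emeasure (density M (\<lambda>\<omega>. ennreal (h \<omega>))) (?Y -` E \<inter> space M)"
      unfolding D_def by (subst emeasure_distr) auto
    also have "\<dots> = (\<integral>\<^sup>+\<omega>. ennreal (h \<omega>) * indicator (?Y -` E \<inter> space M) \<omega> \<partial>M)"
      by (rule emeasure_density) auto
    also have "\<dots> = (\<integral>\<^sup>+\<omega>. ennreal (h \<omega> * indicator E (?Y \<omega>)) \<partial>M)"
      by (intro nn_integral_cong) (auto simp: indicator_def)
    also have "\<dots> = ennreal (LINT \<omega>|M. h \<omega> * indicator E (?Y \<omega>))"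
      using h E by (intro nn_integral_eq_integral int_ind) auto
    finally show ?thesis .
  qed
  have diff: "(LINT \<omega>|M. p \<omega> * indicator E (?Y \<omega>)) - (LINT \<omega>|M. m \<omega> * indicator E (?Y \<omega>))
      = (LINT \<omega>|M. Z \<omega> * indicator E (?Y \<omega>))" if "E \<in> sets ?N" for E
    using int_ind[OF pm(1) that] int_ind[OF pm(2) that] by (simp add: Z_eq left_diff_distrib)
  have "D p = D m"
  proof (rule measure_eqI_PiM_finite[OF \<open>finite I\<close>])
    show "sets (D p) = sets ?N" "sets (D m) = sets ?N"
      by (simp_all add: D_def)
    fix B :: "'i \<Rightarrow> real set"
    assume B: "\<And>i. i \<in> I \<Longrightarrow> B i \<in> sets borel"
    have box: "Pi\<^sub>E I B \<in> sets ?N"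
      using B \<open>finite I\<close> by (intro sets_PiM_I_finite) auto
    have ind: "complex_of_real (Z \<omega> * indicator (Pi\<^sub>E I B) (?Y \<omega>))
        = of_real (Z \<omega>) * (\<Prod>i\<in>I. indicator (B i) (Y i \<omega>))" for \<omega>
    proof (cases "?Y \<omega> \<in> Pi\<^sub>E I B")
      case True
      then have "(\<Prod>i\<in>I. indicator (B i) (Y i \<omega>)) = (1::complex)"
        by (intro prod.neutral) (auto simp: PiE_iff indicator_def)
      with True show ?thesis by simp
    next
      case False
      then obtain i where "i \<in> I" "Y i \<omega> \<notin> B i"
        by (auto simp: PiE_iff)
      then have "(\<Prod>i\<in>I. indicator (B i) (Y i \<omega>)) = (0::complex)"
        using \<open>finite I\<close> by (intro prod_zero bexI[of _ i]) auto
      with False show ?thesis by simp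
    qed
    have "complex_of_real (LINT \<omega>|M. Z \<omega> * indicator (Pi\<^sub>E I B) (?Y \<omega>))
        = (CLINT \<omega>|M. of_real (Z \<omega>) * (\<Prod>i\<in>I. indicator (B i) (Y i \<omega>)))"
      unfolding ind[symmetric] by (rule integral_complex_of_real[symmetric])
    also have "\<dots> = 0"
      using weighted_iexp_zero_imp_box_zero[OF \<open>finite I\<close> integrable_of_real[OF Z] Y zero B subset_refl]
      by simp
    finally show "emeasure (D p) (Pi\<^sub>E I B) = emeasure (D m) (Pi\<^sub>E I B)"
      using diff[OF box] by (simp add: D pm box)
  next
    show "range (\<lambda>_::nat. space ?N) \<subseteq> prod_algebra I (\<lambda>_. borel)"
      using \<open>finite I\<close> by (auto simp: space_PiM intro!: prod_algebraI_finite)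
    show "(\<Union>i::nat. space ?N) = space ?N"
      by simp
    show "emeasure (D p) (space ?N) \<noteq> \<infinity>" for i :: nat
      by (simp add: D pm)
  qed
  moreover obtain E where E: "E \<in> sets ?N" "A = ?Y -` E \<inter> space M"
    using A unfolding sets_vimage_algebra2[OF Y_space] by auto
  ultimately have "ennreal (LINT \<omega>|M. p \<omega> * indicator E (?Y \<omega>)) = ennreal (LINT \<omega>|M. m \<omega> * indicator E (?Y \<omega>))"
    using D[OF pm(1,3) E(1)] D[OF pm(2,4) E(1)] by simp
  then have "(LINT \<omega>|M. Z \<omega> * indicator E (?Y \<omega>)) = 0"
    using diff[OF E(1)] pm by (simp add: Bochner_Integration.integral_nonneg)
  moreover have "(LINT \<omega>:A|M. Z \<omega>) = (LINT \<omega>|M. Z \<omega> * indicator E (?Y \<omega>))"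
    unfolding set_lebesgue_integral_def E(2)
    by (intro Bochner_Integration.integral_cong) (auto simp: indicator_def)
  ultimately show ?thesis
    by simp
qed

section \<open>Shadow boundaries and faces\<close>

lemma frontier_if_supported:
  fixes x u :: "'a::euclidean_space"
  assumes "x \<in> S" "u \<noteq> 0" and le: "\<And>y. y \<in> S \<Longrightarrow> y \<bullet> u \<le> x \<bullet> u"
  shows "x \<in> frontier S"
proof -
  have "x \<notin> interior S"
  proof
    assume "x \<in> interior S"
    then obtain e where e: "0 < e" "cball x e \<subseteq> S"
      by (auto simp: mem_interior_cball)
    have "x + (e / norm u) *\<^sub>R u \<in> cball x e"
      using \<open>u \<noteq> 0\<close> e by (simp add: dist_norm)
    with e have "(x + (e / norm u) *\<^sub>R u) \<bullet> u \<le> x \<bullet> u"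
      by (intro le) auto
    then have "e / norm u * (u \<bullet> u) \<le> 0"
      by (simp add: inner_add_left)
    moreover have "0 < e / norm u * (u \<bullet> u)"
      using e \<open>u \<noteq> 0\<close> by simp
    ultimately show False
      by simp
  qed
  then show ?thesis
    using \<open>x \<in> S\<close> closure_subset[of S] by (auto simp: frontier_def)
qed

text \<open>
  If \<open>S\<close> has empty interior, \<open>x\<close> may lie in the relative interior. Then the normal of a hyperplane
  that contains all of \<open>S\<close> serves as \<open>u\<close>.
\<close>

lemma supporting_hyperplane_frontier:
  fixes x :: "'a::euclidean_space"
  assumes "convex S" "x \<in> frontier S"
  obtains u where "u \<noteq> 0" "\<And>y. y \<in> S \<Longrightarrow> y \<bullet> u \<le> x \<bullet> u"
proof -
  have x: "x \<in> closure S" "x \<notin> interior S"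
    using assms by (auto simp: frontier_def)
  show thesis
  proof (cases "interior S = {}")
    case True
    then obtain a b where a: "a \<noteq> 0" "S \<subseteq> {y. a \<bullet> y = b}"
      using empty_interior_subset_hyperplane[OF \<open>convex S\<close>] by metis
    then have "closure S \<subseteq> {y. a \<bullet> y = b}"
      by (intro closure_minimal closed_hyperplane)
    with x have "a \<bullet> x = b"
      by blast
    with a show thesis
      by (intro that[of a]) (auto simp: inner_commute)
  next
    case False
    then have "x \<notin> rel_interior S"
      using x by (simp add: rel_interior_nonempty_interior)
    then obtain a where a: "a \<noteq> 0" "\<And>y. y \<in> closure S \<Longrightarrow> a \<bullet> x \<le> a \<bullet> y"
      using supporting_hyperplane_relative_frontier[OF \<open>convex S\<close> x(1)] by metis
    show thesis
    proof (rule that[of "- a"])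
      show "y \<bullet> - a \<le> x \<bullet> - a" if "y \<in> S" for y
        using a(2)[of y] that closure_subset[of S] by (auto simp: inner_commute)
    qed (use a in simp)
  qed
qed

text \<open>
  A linear form that is bounded above on \<open>K + span {e}\<close> must vanish on \<open>e\<close>, and its maxima over
  \<open>K + span {e}\<close> and over \<open>K\<close> then agree. Hence supporting hyperplanes of the cylinder at points of \<open>K\<close>
  are those of \<open>K\<close> whose normal is orthogonal to \<open>e\<close>.
\<close>

lemma shadow_boundary_iff_supported:
  fixes K :: "'a::euclidean_space set"
  assumes "convex K" "compact K"
  shows "x \<in> shadow_boundary K e \<longleftrightarrow>
    x \<in> K \<and> (\<exists>u. u \<noteq> 0 \<and> u \<bullet> e = 0 \<and> (\<forall>y\<in>K. y \<bullet> u \<le> x \<bullet> u))"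
proof safe
  assume "x \<in> shadow_boundary K e"
  then have fr: "x \<in> frontier (K + span {e})" "x \<in> frontier K"
    by (auto simp: shadow_boundary_def)
  from fr(2) show xK: "x \<in> K"
    using compact_imp_closed[OF \<open>compact K\<close>] frontier_subset_eq by blast
  have "convex (K + span {e})"
    using \<open>convex K\<close> subspace_imp_convex[OF subspace_span] by (rule convex_set_plus)
  then obtain u where u: "u \<noteq> 0" "\<And>y. y \<in> K + span {e} \<Longrightarrow> y \<bullet> u \<le> x \<bullet> u"
    using fr(1) by (rule supporting_hyperplane_frontier) blast
  have line: "(y + t *\<^sub>R e) \<bullet> u \<le> x \<bullet> u" if "y \<in> K" for y t
    using that by (intro u set_plus_intro) (auto simp: span_mul span_base)
  have "u \<bullet> e = 0"
    using line[OF xK, of 1] line[OF xK, of "-1"] by (simp add: inner_add_left inner_diff_left inner_commute[of u])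
  moreover have "\<forall>y\<in>K. y \<bullet> u \<le> x \<bullet> u"
    using line[of _ 0] by simp
  ultimately show "\<exists>u. u \<noteq> 0 \<and> u \<bullet> e = 0 \<and> (\<forall>y\<in>K. y \<bullet> u \<le> x \<bullet> u)"
    using u(1) by blast
next
  fix u
  assume x: "x \<in> K" and u: "u \<noteq> 0" "u \<bullet> e = 0" "\<forall>y\<in>K. y \<bullet> u \<le> x \<bullet> u"
  have "x \<in> frontier (K + span {e})"
  proof (rule frontier_if_supported[OF _ u(1)])
    show "x \<in> K + span {e}"
      using set_plus_intro[OF x span_zero] by simp
    fix y assume "y \<in> K + span {e}"
    then obtain z t where "z \<in> K" "y = z + t *\<^sub>R e"
      by (auto simp: set_plus_def span_singleton)
    with u show "y \<bullet> u \<le> x \<bullet> u"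
      by (simp add: inner_add_left inner_commute[of e u])
  qed
  moreover have "x \<in> frontier K"
    using x u by (intro frontier_if_supported) auto
  ultimately show "x \<in> shadow_boundary K e"
    by (simp add: shadow_boundary_def)
qed

lemma inner_le_support_function:
  fixes K :: "'a::euclidean_space set"
  assumes "compact K" "x \<in> K"
  shows "x \<bullet> u \<le> support_function K u"
proof -
  have "compact ((\<lambda>x. x \<bullet> u) ` K)"
    using \<open>compact K\<close> by (intro compact_continuous_image continuous_intros)
  then show ?thesis
    unfolding support_function_def using \<open>x \<in> K\<close>
    by (intro cSUP_upper bounded_imp_bdd_above compact_imp_bounded)
qed

lemma support_function_eq_if_supported:
  fixes K :: "'a::euclidean_space set"
  assumes "x \<in> K" "\<And>y. y \<in> K \<Longrightarrow> y \<bullet> u \<le> x \<bullet> u"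
  shows "support_function K u = x \<bullet> u"
  unfolding support_function_def using assms by (intro cSup_eq_maximum) auto

lemma support_point_exists:
  fixes K :: "'a::euclidean_space set"
  assumes "compact K" "K \<noteq> {}"
  obtains x where "x \<in> K" "\<And>y. y \<in> K \<Longrightarrow> y \<bullet> u \<le> x \<bullet> u"
proof -
  have "continuous_on K (\<lambda>x. x \<bullet> u)"
    by (intro continuous_intros)
  from continuous_attains_sup[OF assms this] show thesis
    using that by blast
qed

lemma zero_mem_if_symmetric_convex:
  fixes K :: "'a::euclidean_space set"
  assumes "convex K" "uminus ` K = K" "K \<noteq> {}"
  shows "0 \<in> K"
proof -
  obtain x where "x \<in> K" "- x \<in> K"
    using assms by blast
  then show ?thesis
    using convexD[OF \<open>convex K\<close>, of x "- x" "1/2" "1/2"] by simp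
qed

text \<open>
  By symmetry of \<open>K\<close> the shadow boundary contains \<open>- x\<close> with each of its points \<open>x\<close>, so the hyperplane
  passes through the origin and its normal can be scaled to have \<open>k\<close>-th coordinate \<open>1\<close>. Only in
  dimension one is the shadow boundary empty; the conclusion then concerns \<open>u = 0\<close> alone, for which
  the point \<open>0\<close> of \<open>K\<close> works.
\<close>

lemma shadow_hyperplane_normal:
  fixes K :: "(real ^ 'n) set"
  assumes "convex K" "compact K" "K \<noteq> {}" and sym: "uminus ` K = K"
    and sub: "shadow_boundary K (axis k 1) \<subseteq> {x. n \<bullet> x = c}" and k: "axis k 1 \<notin> {x. n \<bullet> x = c}"
  obtains v where "v $ k = 1"
    "\<And>u. u $ k = 0 \<Longrightarrow> \<exists>x\<in>K. support_function K u = x \<bullet> u \<and> x \<bullet> v = 0"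
proof -
  have orth: "u \<bullet> axis k 1 = u $ k" for u :: "real ^ 'n"
    by (simp add: inner_axis)
  have "0 \<in> K"
    using assms by (intro zero_mem_if_symmetric_convex)
  then have at_zero: "\<exists>x\<in>K. support_function K 0 = x \<bullet> 0 \<and> x \<bullet> v = 0" for v
    by (intro bexI[of _ 0] conjI support_function_eq_if_supported) auto
  have on_hyperplane: "\<exists>x\<in>K. support_function K u = x \<bullet> u \<and> n \<bullet> x = 0 \<and> c = 0"
    if u: "u \<noteq> 0" "u $ k = 0" for u
  proof -
    obtain x where x: "x \<in> K" "\<And>y. y \<in> K \<Longrightarrow> y \<bullet> u \<le> x \<bullet> u"
      using support_point_exists[OF \<open>compact K\<close> \<open>K \<noteq> {}\<close>] by metis
    have neg: "- y \<in> K" if "y \<in> K" for y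
      using sym that by blast
    have "x \<in> shadow_boundary K (axis k 1)"
      using x u assms by (subst shadow_boundary_iff_supported) (auto simp: orth)
    moreover have "- x \<in> shadow_boundary K (axis k 1)"
      unfolding shadow_boundary_iff_supported[OF assms(1,2)]
    proof (intro conjI exI[of _ "- u"] ballI)
      show "y \<bullet> - u \<le> - x \<bullet> - u" if "y \<in> K" for y
        using x(2)[OF neg[OF that]] by simp
    qed (use x u neg in \<open>auto simp: orth\<close>)
    ultimately have "n \<bullet> x = c" "- (n \<bullet> x) = c"
      using sub by auto
    with x show ?thesis
      by (intro bexI[of _ x] conjI support_function_eq_if_supported) auto
  qed
  show thesis
  proof (cases "\<exists>u::real ^ 'n. u \<noteq> 0 \<and> u $ k = 0")
    case True
    then obtain w :: "real ^ 'n" where "w \<noteq> 0" "w $ k = 0"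
      by blast
    then have "c = 0"
      using on_hyperplane[of w] by blast
    with k have n: "n $ k \<noteq> 0"
      by (simp add: inner_axis)
    show thesis
    proof (rule that[of "(1 / n $ k) *\<^sub>R n"])
      fix u :: "real ^ 'n"
      assume "u $ k = 0"
      then show "\<exists>x\<in>K. support_function K u = x \<bullet> u \<and> x \<bullet> (1 / n $ k) *\<^sub>R n = 0"
        using on_hyperplane[of u] at_zero[of "(1 / n $ k) *\<^sub>R n"]
        by (cases "u = 0") (auto simp: inner_commute[of _ n])
    qed (use n in simp)
  next
    case False
    show thesis
    proof (rule that[of "axis k 1"])
      fix u :: "real ^ 'n"
      assume "u $ k = 0"
      with False have "u = 0"
        by blast
      then show "\<exists>x\<in>K. support_function K u = x \<bullet> u \<and> x \<bullet> axis k 1 = 0"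
        using at_zero by simp
    qed simp
  qed
qed

section \<open>Derivatives of the characteristic function\<close>

lemma has_vector_derivative_at_iff_quotient:
  fixes f :: "real \<Rightarrow> 'a::real_normed_vector"
  shows "(f has_vector_derivative D) (at x) \<longleftrightarrow> ((\<lambda>s. (f s - f x) /\<^sub>R (s - x)) \<longlongrightarrow> D) (at x)"
proof -
  have *: "norm (f s - f x - (s - x) *\<^sub>R D) / norm (s - x) = norm ((f s - f x) /\<^sub>R (s - x) - D)"
    if "s \<noteq> x" for s
  proof -
    have "(f s - f x) /\<^sub>R (s - x) - D = (f s - f x - (s - x) *\<^sub>R D) /\<^sub>R (s - x)"
      using that by (simp add: scaleR_diff_right)
    then show ?thesis
      by (simp add: divide_inverse mult.commute)
  qed
  have "((\<lambda>s. norm (f s - f x - (s - x) *\<^sub>R D) / norm (s - x)) \<longlongrightarrow> 0) (at x) \<longleftrightarrow>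
      ((\<lambda>s. norm ((f s - f x) /\<^sub>R (s - x) - D)) \<longlongrightarrow> 0) (at x)"
    by (intro tendsto_cong) (simp add: eventually_at_filter * del: real_norm_def)
  then show ?thesis
    unfolding has_vector_derivative_def has_derivative_iff_norm
    by (simp add: tendsto_norm_zero_iff LIM_zero_iff bounded_linear_scaleR_left)
qed

text \<open>
  Differentiation under the expectation: the difference quotients are dominated by \<open>\<bar>B\<bar>\<close>.
\<close>

lemma (in prob_space) char_has_vector_derivative:
  fixes A B :: "'a \<Rightarrow> real"
  assumes [measurable]: "A \<in> borel_measurable M" and B: "integrable M B"
  shows "((\<lambda>s. CLINT \<omega>|M. iexp (A \<omega> + s * B \<omega>)) has_vector_derivative
    \<i> * (CLINT \<omega>|M. of_real (B \<omega>) * iexp (A \<omega>))) (at 0)"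
proof -
  note [measurable] = borel_measurable_integrable[OF B]
  define F where "F s = (CLINT \<omega>|M. iexp (A \<omega> + s * B \<omega>))" for s
  have int: "integrable M (\<lambda>\<omega>. iexp (A \<omega> + s * B \<omega>))" for s
    by (rule integrable_const_bound[where B = 1]) auto
  have "((\<lambda>s. (F s - F 0) /\<^sub>R s) \<longlongrightarrow> (CLINT \<omega>|M. \<i> * of_real (B \<omega>) * iexp (A \<omega>))) (at 0)"
    unfolding tendsto_at_iff_sequentially
  proof (intro allI impI)
    fix X :: "nat \<Rightarrow> real"
    assume X0: "\<forall>i. X i \<in> UNIV - {0}" and X: "X \<longlonglongrightarrow> 0"
    have quotient: "(F s - F 0) /\<^sub>R s = (CLINT \<omega>|M. (iexp (A \<omega> + s * B \<omega>) - iexp (A \<omega>)) /\<^sub>R s)" for s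
      unfolding F_def using int[of s] int[of 0]
      by (subst integral_scaleR_right, subst Bochner_Integration.integral_diff) simp_all
    have "(\<lambda>i. CLINT \<omega>|M. (iexp (A \<omega> + X i * B \<omega>) - iexp (A \<omega>)) /\<^sub>R X i)
        \<longlonglongrightarrow> (CLINT \<omega>|M. \<i> * of_real (B \<omega>) * iexp (A \<omega>))"
    proof (rule integral_dominated_convergence[where w = "\<lambda>\<omega>. \<bar>B \<omega>\<bar>"])
      show "AE \<omega> in M. (\<lambda>i. (iexp (A \<omega> + X i * B \<omega>) - iexp (A \<omega>)) /\<^sub>R X i)
          \<longlonglongrightarrow> \<i> * of_real (B \<omega>) * iexp (A \<omega>)"
      proof (rule AE_I2)
        fix \<omega>
        have "((\<lambda>s. iexp (A \<omega> + s * B \<omega>)) has_vector_derivative \<i> * of_real (B \<omega>) * iexp (A \<omega>)) (at 0)"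
        proof -
          have "((\<lambda>z. exp (\<i> * (of_real (A \<omega>) + z * of_real (B \<omega>)))) has_field_derivative
              \<i> * of_real (B \<omega>) * iexp (A \<omega>)) (at (of_real 0))"
            by (auto intro!: derivative_eq_intros)
          from has_vector_derivative_real_field[OF this] show ?thesis
            by simp
        qed
        then have "((\<lambda>s. (iexp (A \<omega> + s * B \<omega>) - iexp (A \<omega>)) /\<^sub>R s)
            \<longlongrightarrow> \<i> * of_real (B \<omega>) * iexp (A \<omega>)) (at 0)"
          unfolding has_vector_derivative_at_iff_quotient by simp
        then show "(\<lambda>i. (iexp (A \<omega> + X i * B \<omega>) - iexp (A \<omega>)) /\<^sub>R X i)
            \<longlonglongrightarrow> \<i> * of_real (B \<omega>) * iexp (A \<omega>)"
          using X0 X unfolding tendsto_at_iff_sequentially by (auto simp: comp_def)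
      qed
      show "AE \<omega> in M. norm ((iexp (A \<omega> + X i * B \<omega>) - iexp (A \<omega>)) /\<^sub>R X i) \<le> \<bar>B \<omega>\<bar>" for i
      proof (rule AE_I2)
        fix \<omega>
        have "iexp (A \<omega> + X i * B \<omega>) - iexp (A \<omega>) = iexp (A \<omega>) * (iexp (X i * B \<omega>) - 1)"
          by (simp add: exp_add distrib_left right_diff_distrib)
        moreover have "norm (iexp (X i * B \<omega>) - 1) \<le> \<bar>X i * B \<omega>\<bar>"
          using iexp_approx1[of "X i * B \<omega>" 0] by simp
        ultimately show "norm ((iexp (A \<omega> + X i * B \<omega>) - iexp (A \<omega>)) /\<^sub>R X i) \<le> \<bar>B \<omega>\<bar>"
          using X0 by (simp only: norm_mult norm_scaleR) (simp add: abs_mult field_simps)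
      qed
    qed (use B in auto)
    then show "((\<lambda>s. (F s - F 0) /\<^sub>R s) \<circ> X) \<longlonglongrightarrow> (CLINT \<omega>|M. \<i> * of_real (B \<omega>) * iexp (A \<omega>))"
      by (simp add: comp_def quotient)
  qed
  then show ?thesis
    unfolding has_vector_derivative_at_iff_quotient F_def by (simp add: mult.assoc)
qed


section \<open>The moment condition in terms of the zonoid\<close>

lemma zonoid_char:
  assumes "associated_zonoid \<alpha> M X K"
  shows "(CLINT \<omega>|M. iexp (X \<omega> \<bullet> u)) = of_real (exp (- (support_function K u powr \<alpha>)))"
  using assms by (auto simp: associated_zonoid_def spectral_measure_def)

lemma zonoid_power_scale:
  assumes "associated_zonoid \<alpha> M X K"
  shows "support_function K (t *\<^sub>R u) powr \<alpha> = \<bar>t\<bar> powr \<alpha> * support_function K u powr \<alpha>"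
proof -
  obtain \<sigma> where \<sigma>: "\<And>u. support_function K u powr \<alpha> = (LINT z|\<sigma>. \<bar>u \<bullet> z\<bar> powr \<alpha>)"
    using assms by (auto simp: associated_zonoid_def)
  then show ?thesis
    by (simp add: abs_mult powr_mult)
qed

lemma support_function_nonneg_if_zonoid:
  assumes "associated_zonoid \<alpha> M X K"
  shows "0 \<le> support_function K u"
proof -
  have "0 \<in> K" "compact K"
    using assms zero_mem_if_symmetric_convex[of K] by (auto simp: associated_zonoid_def)
  then show ?thesis
    using inner_le_support_function[of K 0 u] by simp
qed

lemma (in prob_space) zonoid_integral_versine:
  assumes [measurable]: "X \<in> borel_measurable M" and zonoid: "associated_zonoid \<alpha> M X K"
  shows "(LINT \<omega>|M. 1 - cos (t * (X \<omega> \<bullet> u))) = 1 - exp (- (\<bar>t\<bar> powr \<alpha> * support_function K u powr \<alpha>))"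
    and "integrable M (\<lambda>\<omega>. 1 - cos (t * (X \<omega> \<bullet> u)))"
proof -
  have int: "integrable M (\<lambda>\<omega>. iexp (X \<omega> \<bullet> (t *\<^sub>R u)))"
    by (rule integrable_const_bound[where B = 1]) auto
  have cos_int: "integrable M (\<lambda>\<omega>. cos (t * (X \<omega> \<bullet> u)))"
    by (rule integrable_const_bound[where B = 1]) auto
  then show "integrable M (\<lambda>\<omega>. 1 - cos (t * (X \<omega> \<bullet> u)))"
    by simp
  have "(LINT \<omega>|M. cos (t * (X \<omega> \<bullet> u))) = (LINT \<omega>|M. Re (iexp (X \<omega> \<bullet> (t *\<^sub>R u))))"
    by (simp add: Re_exp)
  also have "\<dots> = Re (CLINT \<omega>|M. iexp (X \<omega> \<bullet> (t *\<^sub>R u)))"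
    using int by (rule integral_Re)
  also have "\<dots> = exp (- (\<bar>t\<bar> powr \<alpha> * support_function K u powr \<alpha>))"
    unfolding zonoid_char[OF zonoid] zonoid_power_scale[OF zonoid] by (rule Re_complex_of_real)
  finally show "(LINT \<omega>|M. 1 - cos (t * (X \<omega> \<bullet> u))) = 1 - exp (- (\<bar>t\<bar> powr \<alpha> * support_function K u powr \<alpha>))"
    using cos_int by (simp add: prob_space)
qed

lemma (in prob_space) zonoid_integrable:
  assumes [measurable]: "X \<in> borel_measurable M" and "1 < \<alpha>"
    and zonoid: "associated_zonoid \<alpha> M X K"
  shows "integrable M (\<lambda>\<omega>. X \<omega> \<bullet> u)"
proof (rule integrable_if_char_near_one[OF _ \<open>1 < \<alpha>\<close>])
  fix t
  have "1 - exp (- y) \<le> y" for y :: real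
    using exp_ge_add_one_self[of "- y"] by simp
  then show "(LINT \<omega>|M. 1 - cos (t * (X \<omega> \<bullet> u))) \<le> support_function K u powr \<alpha> * \<bar>t\<bar> powr \<alpha>"
    unfolding zonoid_integral_versine[OF assms(1) zonoid] by (subst mult.commute) simp
qed simp

text \<open>
  All the expectations of \<open>1 - cos ((X \<bullet> u) / 2\<^sup>n)\<close> vanish, so almost surely all these terms are zero.
  The dyadic bound then excludes \<open>\<bar>X \<bullet> u\<bar> \<ge> 1\<close>, and the term \<open>n = 0\<close> leaves only \<open>X \<bullet> u = 0\<close>.
\<close>

lemma (in prob_space) support_function_zero_imp_AE_zero:
  assumes [measurable]: "X \<in> borel_measurable M" and zonoid: "associated_zonoid \<alpha> M X K"
    and zero: "support_function K u = 0"
  shows "AE \<omega> in M. X \<omega> \<bullet> u = 0"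
proof -
  have "AE \<omega> in M. 1 - cos (1 / 2 ^ n * (X \<omega> \<bullet> u)) = 0" for n :: nat
  proof (subst integral_nonneg_eq_0_iff_AE[symmetric])
    show "(LINT \<omega>|M. 1 - cos (1 / 2 ^ n * (X \<omega> \<bullet> u))) = 0"
      unfolding zonoid_integral_versine[OF assms(1) zonoid] zero by simp
    show "integrable M (\<lambda>\<omega>. 1 - cos (1 / 2 ^ n * (X \<omega> \<bullet> u)))"
      by (rule zonoid_integral_versine(2)[OF assms(1) zonoid])
  qed simp
  then have "AE \<omega> in M. \<forall>n::nat. cos ((X \<omega> \<bullet> u) / 2 ^ n) = 1"
    by (simp add: AE_all_countable)
  then show ?thesis
  proof eventually_elim
    case (elim \<omega>)
    have small: "\<bar>X \<omega> \<bullet> u\<bar> < 1"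
    proof (rule ccontr)
      assume "\<not> \<bar>X \<omega> \<bullet> u\<bar> < 1"
      then obtain n where "\<bar>X \<omega> \<bullet> u\<bar> \<le> 2 / (1 - cos 1) * (2 ^ n * (1 - cos ((X \<omega> \<bullet> u) / 2 ^ n)))"
        using abs_le_dyadic_versine[of "X \<omega> \<bullet> u"] by auto
      with elim have "\<bar>X \<omega> \<bullet> u\<bar> \<le> 0"
        by simp
      with \<open>\<not> \<bar>X \<omega> \<bullet> u\<bar> < 1\<close> show False
        by simp
    qed
    have "cos \<bar>X \<omega> \<bullet> u\<bar> = 1"
      using elim[rule_format, of 0] by simp
    then show ?case
      using small cos_monotone_0_pi[of 0 "\<bar>X \<omega> \<bullet> u\<bar>"] pi_gt3 by fastforce
  qed
qed

text \<open>
  Because the characteristic function is real-valued along the line \<open>u + s v\<close>, its derivative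
  \<open>\<i> E ((X \<bullet> v) exp (\<i> (X \<bullet> u)))\<close> is real as well. One real number \<open>d\<close> thus carries the full complex moment.
\<close>

lemma (in prob_space) zonoid_derivative:
  assumes X [measurable]: "X \<in> borel_measurable M" and "1 < \<alpha>"
    and zonoid: "associated_zonoid \<alpha> M X K"
  obtains d where
    "((\<lambda>s. exp (- (support_function K (u + s *\<^sub>R v) powr \<alpha>))) has_real_derivative d) (at 0)"
    "\<i> * (CLINT \<omega>|M. of_real (X \<omega> \<bullet> v) * iexp (X \<omega> \<bullet> u)) = of_real d"
proof -
  define g where "g s = exp (- (support_function K (u + s *\<^sub>R v) powr \<alpha>))" for s
  define D where "D = \<i> * (CLINT \<omega>|M. of_real (X \<omega> \<bullet> v) * iexp (X \<omega> \<bullet> u))"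
  have "((\<lambda>s. CLINT \<omega>|M. iexp (X \<omega> \<bullet> u + s * (X \<omega> \<bullet> v))) has_vector_derivative D) (at 0)"
    unfolding D_def by (rule char_has_vector_derivative[OF _ zonoid_integrable[OF assms]]) simp
  moreover have "(CLINT \<omega>|M. iexp (X \<omega> \<bullet> u + s * (X \<omega> \<bullet> v))) = of_real (g s)" for s
    using zonoid_char[OF zonoid, of "u + s *\<^sub>R v"] by (simp add: g_def inner_add_right)
  ultimately have D: "((\<lambda>s. of_real (g s)) has_vector_derivative D) (at 0)"
    by simp
  have "((\<lambda>s. Re (of_real (g s))) has_vector_derivative Re D) (at 0)"
    using D by (rule bounded_linear.has_vector_derivative[OF bounded_linear_Re])
  moreover have "((\<lambda>s. Im (of_real (g s))) has_vector_derivative Im D) (at 0)"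
    using D by (rule bounded_linear.has_vector_derivative[OF bounded_linear_Im])
  then have "Im D = 0"
    by (intro vector_derivative_unique_at[of "\<lambda>_. 0" "Im D" 0 0]) auto
  ultimately show thesis
    by (intro that[of "Re D"])
       (auto simp: g_def[symmetric] D_def[symmetric] has_real_derivative_iff_has_vector_derivative complex_eq_iff)
qed

text \<open>
  The support point \<open>x\<close> shows \<open>h(u + s v) \<ge> h(u)\<close> for all \<open>s\<close>, so the characteristic function along
  this line is maximal at \<open>s = 0\<close>.
\<close>

lemma (in prob_space) orthogonal_support_point_imp_moment_zero:
  assumes X: "X \<in> borel_measurable M" and "1 < \<alpha>" and zonoid: "associated_zonoid \<alpha> M X K"
    and x: "x \<in> K" "support_function K u = x \<bullet> u" "x \<bullet> v = 0"
  shows "(CLINT \<omega>|M. of_real (X \<omega> \<bullet> v) * iexp (X \<omega> \<bullet> u)) = 0"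
proof -
  obtain d where d:
    "((\<lambda>s. exp (- (support_function K (u + s *\<^sub>R v) powr \<alpha>))) has_real_derivative d) (at 0)"
    "\<i> * (CLINT \<omega>|M. of_real (X \<omega> \<bullet> v) * iexp (X \<omega> \<bullet> u)) = of_real d"
    by (rule zonoid_derivative[OF assms(1-3)])
  have "compact K"
    using zonoid by (auto simp: associated_zonoid_def)
  have "support_function K u \<le> support_function K (u + s *\<^sub>R v)" for s
    using inner_le_support_function[OF \<open>compact K\<close> x(1), of "u + s *\<^sub>R v"] x
    by (simp add: inner_add_right)
  then have "d = 0"
    using d(1) \<open>1 < \<alpha>\<close>
    by (elim DERIV_local_max[where d = 1])
       (auto intro!: powr_mono2 support_function_nonneg_if_zonoid[OF zonoid])
  with d(2) show ?thesis
    by simp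
qed

text \<open>
  The difference of \<open>exp (- h(u + s v)\<^sup>\<alpha>)\<close> and \<open>exp (- (h(u) + s (x \<bullet> v))\<^sup>\<alpha>)\<close> is nonpositive near
  \<open>s = 0\<close> and vanishes there. Its derivative at \<open>0\<close> is therefore zero, and the derivative of the second
  function is \<open>x \<bullet> v\<close> times a factor that is nonzero because \<open>h(u) > 0\<close>.
\<close>

lemma (in prob_space) moment_zero_imp_orthogonal_support_point:
  assumes X: "X \<in> borel_measurable M" and "1 < \<alpha>" and zonoid: "associated_zonoid \<alpha> M X K"
    and moment: "(CLINT \<omega>|M. of_real (X \<omega> \<bullet> v) * iexp (X \<omega> \<bullet> u)) = 0"
    and x: "x \<in> K" "support_function K u = x \<bullet> u" and pos: "0 < support_function K u"
  shows "x \<bullet> v = 0"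
proof -
  define h where "h = support_function K u"
  define b where "b = x \<bullet> v"
  have "0 < h"
    using pos by (simp add: h_def)
  have "compact K"
    using zonoid by (auto simp: associated_zonoid_def)
  obtain d where d:
    "((\<lambda>s. exp (- (support_function K (u + s *\<^sub>R v) powr \<alpha>))) has_real_derivative d) (at 0)"
    "\<i> * (CLINT \<omega>|M. of_real (X \<omega> \<bullet> v) * iexp (X \<omega> \<bullet> u)) = of_real d"
    by (rule zonoid_derivative[OF assms(1-3)])
  from d(2) have "d = 0"
    using moment by simp
  with d(1) have deriv:
    "((\<lambda>s. exp (- (support_function K (u + s *\<^sub>R v) powr \<alpha>))) has_real_derivative 0) (at 0)"
    by simp
  have lower_deriv: "((\<lambda>s. exp (- ((h + s * b) powr \<alpha>))) has_real_derivative
      - (\<alpha> * h powr (\<alpha> - 1) * b * exp (- (h powr \<alpha>)))) (at 0)"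
    using \<open>0 < h\<close> by (auto intro!: derivative_eq_intros simp: mult_ac)
  have below: "h + s * b \<le> support_function K (u + s *\<^sub>R v)" for s
    using inner_le_support_function[OF \<open>compact K\<close> x(1), of "u + s *\<^sub>R v"] x
    by (simp add: inner_add_right h_def b_def)
  have "0 - - (\<alpha> * h powr (\<alpha> - 1) * b * exp (- (h powr \<alpha>))) = 0"
  proof (rule DERIV_local_max[OF DERIV_diff[OF deriv lower_deriv]])
    \<comment> \<open>within this radius \<open>h + s * b\<close> stays nonnegative, where \<open>powr\<close> is monotone\<close>
    show "0 < h / (\<bar>b\<bar> + 1)"
      using \<open>0 < h\<close> by simp
    show "\<forall>s. \<bar>0 - s\<bar> < h / (\<bar>b\<bar> + 1) \<longrightarrow>
        exp (- (support_function K (u + s *\<^sub>R v) powr \<alpha>)) - exp (- ((h + s * b) powr \<alpha>))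
        \<le> exp (- (support_function K (u + 0 *\<^sub>R v) powr \<alpha>)) - exp (- ((h + 0 * b) powr \<alpha>))"
    proof (intro allI impI)
      fix s :: real
      assume "\<bar>0 - s\<bar> < h / (\<bar>b\<bar> + 1)"
      then have "\<bar>s\<bar> * \<bar>b\<bar> + \<bar>s\<bar> < h"
        by (simp add: field_simps add_pos_nonneg)
      then have "0 \<le> h + s * b"
        using abs_ge_minus_self[of "s * b"] by (simp add: abs_mult)
      then show "exp (- (support_function K (u + s *\<^sub>R v) powr \<alpha>)) - exp (- ((h + s * b) powr \<alpha>))
          \<le> exp (- (support_function K (u + 0 *\<^sub>R v) powr \<alpha>)) - exp (- ((h + 0 * b) powr \<alpha>))"
        using below[of s] \<open>1 < \<alpha>\<close> by (simp add: h_def[symmetric] powr_mono2)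
    qed
  qed
  then show ?thesis
    using \<open>0 < h\<close> \<open>1 < \<alpha>\<close> by (simp add: b_def)
qed

section \<open>Linear conditional expectations as a moment condition\<close>

lemma inner_split_coordinate:
  fixes x v :: "real ^ 'n"
  shows "x \<bullet> v = x $ k * v $ k + (\<Sum>i\<in>- {k}. v $ i * x $ i)"
proof -
  have "x \<bullet> v = (\<Sum>i\<in>UNIV. v $ i * x $ i)"
    by (simp add: inner_vec_def mult.commute)
  also have "\<dots> = v $ k * x $ k + (\<Sum>i\<in>- {k}. v $ i * x $ i)"
    by (subst sum.remove[of _ k]) (auto simp: Compl_eq_Diff_UNIV)
  finally show ?thesis
    by (simp add: mult.commute)
qed

lemma other_coords_algebra_measurable_coord:
  fixes X :: "'w \<Rightarrow> real ^ 'n"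
  assumes "i \<noteq> k"
  shows "(\<lambda>\<omega>. X \<omega> $ i) \<in> borel_measurable (other_coords_algebra M X k)"
proof -
  let ?Y = "\<lambda>\<omega>. \<lambda>i\<in>- {k}. X \<omega> $ i"
  have "?Y \<in> other_coords_algebra M X k \<rightarrow>\<^sub>M (\<Pi>\<^sub>M i\<in>- {k}. borel)"
    unfolding other_coords_algebra_def
    by (rule measurable_vimage_algebra1) (auto simp: space_PiM)
  then have "(\<lambda>\<omega>. ?Y \<omega> i) \<in> borel_measurable (other_coords_algebra M X k)"
    by (rule measurable_compose[OF _ measurable_component_singleton]) (use assms in auto)
  then show ?thesis
    using assms by simp
qed

lemma other_coords_algebra_measurable_inner:
  fixes X :: "'w \<Rightarrow> real ^ 'n"
  assumes "u $ k = 0"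
  shows "(\<lambda>\<omega>. X \<omega> \<bullet> u) \<in> borel_measurable (other_coords_algebra M X k)"
  unfolding inner_split_coordinate[of _ _ k] using assms
  by (auto intro!: borel_measurable_sum borel_measurable_times other_coords_algebra_measurable_coord)

text \<open>
  The coefficients of the prediction are \<open>- v $ i\<close>, so that the residual is \<open>X \<bullet> v\<close>. The moments for
  all \<open>u\<close> with \<open>u $ k = 0\<close> are the Fourier transform of this residual as a weight on the other coordinates.
\<close>

lemma (in prob_space) linear_cond_exp_if_moments_zero:
  fixes X :: "'a \<Rightarrow> real ^ 'n"
  assumes X [measurable]: "X \<in> borel_measurable M" and int: "\<And>u. integrable M (\<lambda>\<omega>. X \<omega> \<bullet> u)"
    and v: "v $ k = 1"
    and moment: "\<And>u. u $ k = 0 \<Longrightarrow> (CLINT \<omega>|M. of_real (X \<omega> \<bullet> v) * iexp (X \<omega> \<bullet> u)) = 0"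
  shows "linear_cond_exp M X k"
proof -
  let ?F = "other_coords_algebra M X k"
  interpret F: finite_measure_subalgebra M ?F
    by unfold_locales (rule subalgebra_other_coords_algebra[OF X])
  have coord_int: "integrable M (\<lambda>\<omega>. X \<omega> $ i)" for i
    using int[of "axis i 1"] by (simp add: inner_axis)
  have sum_int: "integrable M (\<lambda>\<omega>. \<Sum>i\<in>- {k}. - v $ i * X \<omega> $ i)"
    using coord_int by (intro Bochner_Integration.integrable_sum integrable_mult_right)
  have "AE \<omega> in M. real_cond_exp M ?F (\<lambda>\<omega>. X \<omega> $ k) \<omega> = (\<Sum>i\<in>- {k}. - v $ i * X \<omega> $ i)"
  proof (rule F.real_cond_exp_charact[OF _ coord_int sum_int])
    show "(\<lambda>\<omega>. \<Sum>i\<in>- {k}. - v $ i * X \<omega> $ i) \<in> borel_measurable ?F"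
      by (auto intro!: borel_measurable_sum borel_measurable_times other_coords_algebra_measurable_coord)
    fix A
    assume A: "A \<in> sets ?F"
    then have "A \<in> sets M"
      using F.subalg by (auto simp: subalgebra_def)
    have "(LINT \<omega>:A|M. X \<omega> \<bullet> v) = 0"
    proof (rule weighted_iexp_zero_imp_set_integral_zero[where I = "- {k}" and Y = "\<lambda>i \<omega>. X \<omega> $ i"])
      fix t :: "'n \<Rightarrow> real"
      let ?u = "\<chi> i. if i = k then 0 else t i"
      have "X \<omega> \<bullet> ?u = (\<Sum>i\<in>- {k}. t i * X \<omega> $ i)" for \<omega>
        unfolding inner_split_coordinate[of _ _ k] by (auto intro!: sum.cong)
      then show "(CLINT \<omega>|M. of_real (X \<omega> \<bullet> v) * iexp (\<Sum>i\<in>- {k}. t i * X \<omega> $ i)) = 0"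
        using moment[of ?u] by simp
    qed (use A int coord_int[THEN borel_measurable_integrable] in \<open>auto simp: other_coords_algebra_def\<close>)
    moreover have "set_integrable M A (\<lambda>\<omega>. X \<omega> $ k)" "set_integrable M A (\<lambda>\<omega>. \<Sum>i\<in>- {k}. - v $ i * X \<omega> $ i)"
      unfolding set_integrable_def
      by (rule integrable_mult_indicator[OF \<open>A \<in> sets M\<close> coord_int])
         (rule integrable_mult_indicator[OF \<open>A \<in> sets M\<close> sum_int])
    moreover have "X \<omega> \<bullet> v = X \<omega> $ k - (\<Sum>i\<in>- {k}. - v $ i * X \<omega> $ i)" for \<omega>
      using v by (simp add: inner_split_coordinate[of _ _ k] sum_negf)
    ultimately show "(LINT \<omega>:A|M. X \<omega> $ k) = (LINT \<omega>:A|M. \<Sum>i\<in>- {k}. - v $ i * X \<omega> $ i)"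
      by (simp only: set_integral_diff)
  qed
  then show ?thesis
    unfolding linear_cond_exp_def by (intro exI[of _ "\<lambda>i. - v $ i"])
qed

text \<open>
  The residual of a conditional expectation is orthogonal to every bounded function of the other
  coordinates, in particular to the real and the imaginary part of \<open>exp (\<i> (X \<bullet> u))\<close>.
\<close>

lemma (in prob_space) linear_cond_exp_imp_moments_zero:
  fixes X :: "'a \<Rightarrow> real ^ 'n"
  assumes X [measurable]: "X \<in> borel_measurable M" and int: "\<And>u. integrable M (\<lambda>\<omega>. X \<omega> \<bullet> u)"
    and linear: "linear_cond_exp M X k"
  obtains v where "v $ k = 1"
    "\<And>u. u $ k = 0 \<Longrightarrow> (CLINT \<omega>|M. of_real (X \<omega> \<bullet> v) * iexp (X \<omega> \<bullet> u)) = 0"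
proof -
  let ?F = "other_coords_algebra M X k"
  interpret F: finite_measure_subalgebra M ?F
    by unfold_locales (rule subalgebra_other_coords_algebra[OF X])
  have coord_int: "integrable M (\<lambda>\<omega>. X \<omega> $ i)" for i
    using int[of "axis i 1"] by (simp add: inner_axis)
  note [measurable] = coord_int[THEN borel_measurable_integrable]
  obtain a where a: "AE \<omega> in M. real_cond_exp M ?F (\<lambda>\<omega>. X \<omega> $ k) \<omega> = (\<Sum>i\<in>- {k}. a i * X \<omega> $ i)"
    using linear by (auto simp: linear_cond_exp_def)
  define v where "v = (\<chi> i. if i = k then 1 else - a i)"
  have inner_v: "X \<omega> \<bullet> v = X \<omega> $ k - (\<Sum>i\<in>- {k}. a i * X \<omega> $ i)" for \<omega>
    by (simp add: inner_split_coordinate[of _ _ k] v_def sum_negf[symmetric])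
  have sum_int: "integrable M (\<lambda>\<omega>. \<Sum>i\<in>- {k}. a i * X \<omega> $ i)"
    using coord_int by (intro Bochner_Integration.integrable_sum integrable_mult_right)
  note [measurable] = borel_measurable_integrable[OF sum_int]
  have bounded_mult: "integrable M (\<lambda>\<omega>. f \<omega> * g \<omega>)"
    if "\<And>\<omega>. \<bar>f \<omega>\<bar> \<le> 1" "f \<in> borel_measurable M" "integrable M g" for f g :: "'a \<Rightarrow> real"
    using that(3)
    by (rule Bochner_Integration.integrable_bound)
       (use that borel_measurable_integrable[OF that(3)] in \<open>auto simp: abs_mult mult_left_le_one_le\<close>)
  have orth: "(LINT \<omega>|M. f \<omega> * (X \<omega> \<bullet> v)) = 0"
    if f: "f \<in> borel_measurable ?F" "\<And>\<omega>. \<bar>f \<omega>\<bar> \<le> 1" for f :: "'a \<Rightarrow> real"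
  proof -
    have fM [measurable]: "f \<in> borel_measurable M"
      using f(1) by (rule measurable_from_subalg[OF F.subalg])
    have "(LINT \<omega>|M. f \<omega> * X \<omega> $ k) = (LINT \<omega>|M. f \<omega> * real_cond_exp M ?F (\<lambda>\<omega>. X \<omega> $ k) \<omega>)"
      by (rule F.real_cond_exp_intg(2)[OF bounded_mult[OF f(2) fM coord_int] f(1), symmetric]) simp
    also have "\<dots> = (LINT \<omega>|M. f \<omega> * (\<Sum>i\<in>- {k}. a i * X \<omega> $ i))"
    proof (rule integral_cong_AE)
      show "AE \<omega> in M. f \<omega> * real_cond_exp M ?F (\<lambda>\<omega>. X \<omega> $ k) \<omega> = f \<omega> * (\<Sum>i\<in>- {k}. a i * X \<omega> $ i)"
        using a by eventually_elim simp
    qed simp_all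
    finally show ?thesis
      unfolding inner_v right_diff_distrib
      using bounded_mult[OF f(2) fM coord_int] bounded_mult[OF f(2) fM sum_int] by simp
  qed
  show thesis
  proof (rule that[of v])
    fix u :: "real ^ 'n"
    assume "u $ k = 0"
    note [measurable] = other_coords_algebra_measurable_inner[OF this, of X M]
    have zero: "(LINT \<omega>|M. cos (X \<omega> \<bullet> u) * (X \<omega> \<bullet> v)) = 0" "(LINT \<omega>|M. sin (X \<omega> \<bullet> u) * (X \<omega> \<bullet> v)) = 0"
      by (intro orth; measurable; simp)+
    have "integrable M (\<lambda>\<omega>. complex_of_real (X \<omega> \<bullet> v) * iexp (X \<omega> \<bullet> u))"
      by (rule Bochner_Integration.integrable_bound[OF int[of v]]) (auto simp: norm_mult)
    then show "(CLINT \<omega>|M. of_real (X \<omega> \<bullet> v) * iexp (X \<omega> \<bullet> u)) = 0"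
      using zero
      by (intro complex_eqI)
         (simp_all add: integral_Re[symmetric] integral_Im[symmetric] Re_exp Im_exp mult.commute
           del: integral_Re integral_Im)
  qed (simp add: v_def)
qed

section \<open>Linearity and the shadow boundary\<close>

theorem theorem9p4:
  fixes M :: "'w measure" and X :: "'w \<Rightarrow> real ^ 'n" and k :: 'n
    and \<alpha> :: real and K :: "(real ^ 'n) set"
  assumes "prob_space M"
    and "X \<in> borel_measurable M"
    and "1 < \<alpha>" and "\<alpha> \<le> 2"
    and "sym_stable \<alpha> M X"
    and "associated_zonoid \<alpha> M X K"
  shows "((\<forall>u. u \<noteq> 0 \<and> u $ k = 0 \<longrightarrow> \<not> (AE \<omega> in M. X \<omega> \<bullet> u = 0)) \<longrightarrow>
            (linear_cond_exp M X k \<longleftrightarrow>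
              (\<exists>n c. n \<noteq> 0 \<and> shadow_boundary K (axis k 1) \<subseteq> {x. n \<bullet> x = c} \<and>
                     axis k 1 \<notin> {x. n \<bullet> x = c}))) \<and>
         ((\<exists>n c. n \<noteq> 0 \<and> shadow_boundary K (axis k 1) \<subseteq> {x. n \<bullet> x = c} \<and>
                 axis k 1 \<notin> {x. n \<bullet> x = c}) \<longrightarrow>
            linear_cond_exp M X k)"
    (is "(?nondegenerate \<longrightarrow> (?linear \<longleftrightarrow> ?planar)) \<and> (?planar \<longrightarrow> ?linear)")
proof -
  interpret prob_space M by fact
  note X = assms(2) and \<alpha> = assms(3) and zonoid = assms(6)
  have K: "convex K" "compact K" "K \<noteq> {}" "uminus ` K = K"
    using zonoid by (auto simp: associated_zonoid_def)
  note int = zonoid_integrable[OF X \<alpha> zonoid]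
  have linear: ?linear if planar: ?planar
  proof -
    obtain n c where nc: "shadow_boundary K (axis k 1) \<subseteq> {x. n \<bullet> x = c}" "axis k 1 \<notin> {x. n \<bullet> x = c}"
      using planar by blast
    obtain v where v: "v $ k = 1"
      "\<And>u. u $ k = 0 \<Longrightarrow> \<exists>x\<in>K. support_function K u = x \<bullet> u \<and> x \<bullet> v = 0"
      using shadow_hyperplane_normal[OF K nc] by metis
    show ?linear
      using v(2) orthogonal_support_point_imp_moment_zero[OF X \<alpha> zonoid]
      by (intro linear_cond_exp_if_moments_zero[OF X int v(1)]) blast
  qed
  have planar: ?planar if nondegenerate: ?nondegenerate and linear: ?linear
  proof -
    obtain v where v: "v $ k = 1"
      "\<And>u. u $ k = 0 \<Longrightarrow> (CLINT \<omega>|M. of_real (X \<omega> \<bullet> v) * iexp (X \<omega> \<bullet> u)) = 0"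
      using linear_cond_exp_imp_moments_zero[OF X int linear] by metis
    have "v \<bullet> x = 0" if shadow: "x \<in> shadow_boundary K (axis k 1)" for x
    proof -
      obtain u where x: "x \<in> K" and u': "u \<noteq> 0" "u \<bullet> axis k 1 = 0" "\<forall>y\<in>K. y \<bullet> u \<le> x \<bullet> u"
        using shadow unfolding shadow_boundary_iff_supported[OF K(1,2)] by blast
      then have u: "u \<noteq> 0" "u $ k = 0" "\<forall>y\<in>K. y \<bullet> u \<le> x \<bullet> u"
        by (simp_all add: inner_axis)
      have "support_function K u \<noteq> 0"
        using nondegenerate u support_function_zero_imp_AE_zero[OF X zonoid] by blast
      then have "0 < support_function K u"
        using support_function_nonneg_if_zonoid[OF zonoid, of u] by simp
      then have "x \<bullet> v = 0"
        using x u v(2)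
        by (intro moment_zero_imp_orthogonal_support_point[OF X \<alpha> zonoid, of v u])
           (auto intro: support_function_eq_if_supported)
      then show ?thesis
        by (simp add: inner_commute)
    qed
    moreover have "v \<bullet> axis k 1 = 1" "v \<noteq> 0"
      using v(1) by (auto simp: inner_axis)
    ultimately show ?planar
      by (intro exI[of _ v] exI[of _ 0]) auto
  qed
  from linear planar show ?thesis
    by blast
qed

end
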